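(* Let $n\geq 1$ and $1\leq k\leq n$ be integers, let $\lambda$ be a partition of $n=\sum_{j=1}^k\lambda_j$ having exactly $k$ nonzero parts $\lambda_1\geq\lambda_2\geq\dots\geq\lambda_k\geq 1$, and let $\mu=(\mu_0,\dots,\mu_n)\in\mathbb N^{n+1}$ (with $0\in\mathbb N$) be a vector of natural integers such that $\sum_{j=0}^n\mu_j=k-1$. Then the number of hypertrees with vertex set $\{0,\dots,n\}$ in which vertex $i$ has degree $\deg(i)=1+\mu_i$ for every $i\in\{0,\dots,n\}$ and which have exactly $k$ hyperedges, of sizes $1+\lambda_1,\dots,1+\lambda_k$ (as a multiset), is $$\binom{n}{\lambda}\frac{1}{\prod_{j=1}^n(\nu_j)!}\binom{k-1}{\mu}=\frac{n!}{\left(\prod_{j=1}^k\lambda_j!\right)}\,\frac{1}{\left(\prod_{j=1}^n(\nu_j)!\right)}\,\frac{(k-1)!}{\left(\prod_{j=0}^n\mu_j!\right)},$$ where $\nu_j=\sharp\{i\mid\lambda_i=j\}$ is the number of parts of length $j$ in $\lambda$.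
   Context: A (finite) hypergraph is a pair $(\mathcal V,\mathcal E)$ consisting of a finite set $\mathcal V$ of vertices and a set $\mathcal E$ of hyperedges, which are subsets of $\mathcal V$ containing at least two elements. The size of a hyperedge $E$ is its number of vertices; the degree $\deg(v)$ of a vertex $v$ is the number of hyperedges containing $v$. Two distinct vertices are adjacent if they are both contained in some hyperedge. A path of length $k$ joining $v$ and $w$ is a sequence $v_0=v,v_1,\dots,v_k=w$ of vertices that are consecutively adjacent. A hypergraph is connected if any two vertices can be joined by a path. A cycle of length $k$ (for $k\geq 3$) is a closed path consisting of $k$ distinct vertices. A hyperforest is a hypergraph such that two distinct hyperedges intersect in at most one common vertex and such that every cycle is contained in a hyperedge. A hypertree is a connected hyperforest. Hypertrees are counted as labelled objects: two hypertrees on $\{0,\dots,n\}$ are the same only if their hyperedge sets are equal. Multinomial coefficients: $\binom{n}{\lambda}=\frac{n!}{\prod_{j=1}^k\lambda_j!}$ and $\binom{k-1}{\mu}=\frac{(k-1)!}{\prod_{j=0}^n\mu_j!}$. *)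

theory Defs
  imports Complex_Main "HOL-Library.Multiset"
begin

text \<open>A hypergraph is given by its vertex set \<open>V\<close> and its set \<open>H\<close> of hyperedges.\<close>

definition hypergraph :: "'a set \<Rightarrow> 'a set set \<Rightarrow> bool" where
  "hypergraph V H \<longleftrightarrow> finite V \<and> (\<forall>E\<in>H. E \<subseteq> V \<and> 2 \<le> card E)"

definition hdegree :: "'a set set \<Rightarrow> 'a \<Rightarrow> nat" where
  "hdegree H v = card {E \<in> H. v \<in> E}"

definition hadjacent :: "'a set set \<Rightarrow> 'a \<Rightarrow> 'a \<Rightarrow> bool" where
  "hadjacent H v w \<longleftrightarrow> v \<noteq> w \<and> (\<exists>E\<in>H. v \<in> E \<and> w \<in> E)"

text \<open>The list \<open>[v\<^sub>0, \<dots>, v\<^sub>k]\<close> is a path of length \<open>k\<close>; paths of length \<open>0\<close> are allowed.\<close>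

definition hpath :: "'a set \<Rightarrow> 'a set set \<Rightarrow> 'a list \<Rightarrow> bool" where
  "hpath V H p \<longleftrightarrow> p \<noteq> [] \<and> set p \<subseteq> V \<and> successively (hadjacent H) p"

definition hconnected :: "'a set \<Rightarrow> 'a set set \<Rightarrow> bool" where
  "hconnected V H \<longleftrightarrow> (\<forall>v\<in>V. \<forall>w\<in>V. \<exists>p. hpath V H p \<and> hd p = v \<and> last p = w)"

text \<open>A cycle of length \<open>k\<close> is a list \<open>[v\<^sub>0, \<dots>, v\<^sub>k]\<close> with \<open>v\<^sub>k = v\<^sub>0\<close>, where
  \<open>v\<^sub>0, \<dots>, v\<^bsub>k-1\<^esub>\<close> are distinct.\<close>

definition hcycle :: "'a set \<Rightarrow> 'a set set \<Rightarrow> 'a list \<Rightarrow> bool" where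
  "hcycle V H c \<longleftrightarrow> hpath V H c \<and> last c = hd c \<and> distinct (butlast c) \<and> 3 \<le> length (butlast c)"

definition hyperforest :: "'a set \<Rightarrow> 'a set set \<Rightarrow> bool" where
  "hyperforest V H \<longleftrightarrow> hypergraph V H \<and>
     (\<forall>E\<in>H. \<forall>F\<in>H. E \<noteq> F \<longrightarrow> card (E \<inter> F) \<le> 1) \<and>
     (\<forall>c. hcycle V H c \<longrightarrow> (\<exists>E\<in>H. set c \<subseteq> E))"

definition hypertree :: "'a set \<Rightarrow> 'a set set \<Rightarrow> bool" where
  "hypertree V H \<longleftrightarrow> hyperforest V H \<and> hconnected V H"

definition multinomial :: "nat \<Rightarrow> nat set \<Rightarrow> (nat \<Rightarrow> nat) \<Rightarrow> real" where
  "multinomial N J a = fact N / (\<Prod>j\<in>J. fact (a j))"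

end

theory Submission
  imports Defs "HOL-Library.FuncSet"
begin

text \<open>
  The prescribed sizes satisfy \<open>\<Sum>(\<bar>E\<bar> - 1) = \<bar>V\<bar> - 1\<close>. A connected hypergraph
  cannot have a smaller left-hand side, because growing a vertex set one hyperedge \<open>E\<close> at a time adds at
  most \<open>\<bar>E\<bar> - 1\<close> vertices per step (\<open>fam_connected_card_le\<close>). Hence no vertex can be dropped from a
  hyperedge without destroying connectedness. Two hyperedges with two common vertices, or a cycle
  lying in no single hyperedge, would permit such a deletion, so under this numerical condition the
  hypertrees are exactly the connected hypergraphs (\<open>tight_hypergraph_hypertree_iff\<close>), and the
  acyclicity conditions can be forgotten.

  It remains to count connected hypergraphs. Labelling the hyperedges by an index set \<open>J\<close> turns them
  into families \<open>F\<close> of subsets of \<open>V\<close>, in other words into bipartite trees on \<open>V\<close> and \<open>J\<close> with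
  prescribed degrees; now repeated and one-element sets are admitted, which makes the class
  closed under removal of leaves. Their number is the product of multinomial coefficients
  \<open>(\<bar>V\<bar> - 1)! / \<Prod>\<lambda>\<^sub>j! \<cdot> (\<bar>J\<bar> - 1)! / \<Prod>\<mu>\<^sub>v!\<close> (\<open>card_families\<close>). Indeed, if some vertex \<open>x\<close> has degree one,
  sorting by the set containing \<open>x\<close> and removing \<open>x\<close> yields the Pascal recurrence for the first factor; otherwise
  \<open>\<bar>V\<bar> < \<bar>J\<bar>\<close>, so some set is a singleton, and sorting by its element and removing the set
  yields the recurrence for the second factor.

  When all sets have at least two elements, the sets of a family are distinct, so a hypertree arises
  from as many families as there are size-preserving bijections from \<open>J\<close> to its hyperedges. That number is
  \<open>\<Prod>\<nu>\<^sub>j!\<close> for every hypertree (\<open>card_colour_preserving_bijections\<close>), which accounts for the remaining denominator.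
\<close>

section \<open>Connected families of sets\<close>

definition closed_under :: "'b set \<Rightarrow> ('b \<Rightarrow> 'a set) \<Rightarrow> 'a set \<Rightarrow> bool" where
  "closed_under J F S \<longleftrightarrow> (\<forall>j\<in>J. F j \<inter> S \<noteq> {} \<longrightarrow> F j \<subseteq> S)"

text \<open>Connectedness is phrased through closed sets rather than paths: removing a leaf or shrinking a
  set then only requires comparing the closed sets of two families.\<close>

definition fam_connected :: "'a set \<Rightarrow> 'b set \<Rightarrow> ('b \<Rightarrow> 'a set) \<Rightarrow> bool" where
  "fam_connected V J F \<longleftrightarrow> (\<forall>S\<subseteq>V. S \<noteq> {} \<longrightarrow> closed_under J F S \<longrightarrow> S = V)"

lemma closed_underD: "closed_under J F S \<Longrightarrow> j \<in> J \<Longrightarrow> v \<in> F j \<Longrightarrow> v \<in> S \<Longrightarrow> w \<in> F j \<Longrightarrow> w \<in> S"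
  unfolding closed_under_def by blast

lemma closed_under_fun_upd:
  "closed_under J (F(i := A)) S \<longleftrightarrow> closed_under (J - {i}) F S \<and> (i \<in> J \<longrightarrow> A \<inter> S \<noteq> {} \<longrightarrow> A \<subseteq> S)"
proof -
  have "closed_under J (F(i := A)) S \<longleftrightarrow>
      (\<forall>j\<in>J - {i}. (F(i := A)) j \<inter> S \<noteq> {} \<longrightarrow> (F(i := A)) j \<subseteq> S) \<and>
      (i \<in> J \<longrightarrow> (F(i := A)) i \<inter> S \<noteq> {} \<longrightarrow> (F(i := A)) i \<subseteq> S)"
    unfolding closed_under_def by blast
  then show ?thesis unfolding closed_under_def by simp
qed

lemma fam_connectedD: "fam_connected V J F \<Longrightarrow> S \<subseteq> V \<Longrightarrow> S \<noteq> {} \<Longrightarrow> closed_under J F S \<Longrightarrow> S = V"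
  unfolding fam_connected_def by blast

text \<open>The vertices reachable from a fixed vertex form a closed set; conversely, a path cannot leave
  a closed set.\<close>

lemma hconnected_iff_fam_connected:
  assumes "hypergraph V H"
  shows "hconnected V H \<longleftrightarrow> fam_connected V H id"
proof
  assume con: "hconnected V H"
  show "fam_connected V H id"
    unfolding fam_connected_def
  proof (intro allI impI)
    fix S assume S: "S \<subseteq> V" "S \<noteq> {}" "closed_under H id S"
    then obtain v where v: "v \<in> S" by blast
    have walk: "p \<noteq> [] \<Longrightarrow> hd p \<in> S \<Longrightarrow> successively (hadjacent H) p \<Longrightarrow> last p \<in> S" for p
    proof (induction p rule: induct_list012)
      case (3 a b p)
      from 3(5) obtain E where "E \<in> H" "a \<in> E" "b \<in> E" by (auto simp: hadjacent_def)
      then have "b \<in> S" using S(3) 3(4) by (auto simp: closed_under_def)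
      then show ?case using 3 by auto
    qed auto
    have "V \<subseteq> S"
    proof
      fix w assume "w \<in> V"
      then obtain p where "hpath V H p" "hd p = v" "last p = w"
        using con v S(1) unfolding hconnected_def by blast
      then show "w \<in> S" using walk[of p] v by (auto simp: hpath_def)
    qed
    then show "S = V" using S(1) by blast
  qed
next
  assume con: "fam_connected V H id"
  show "hconnected V H"
    unfolding hconnected_def
  proof (intro ballI)
    fix v w assume v: "v \<in> V" and w: "w \<in> V"
    define S where "S = {u \<in> V. \<exists>p. hpath V H p \<and> hd p = v \<and> last p = u}"
    have "hpath V H [v] \<and> hd [v] = v \<and> last [v] = v" using v by (simp add: hpath_def)
    then have vS: "v \<in> S" using v unfolding S_def by blast
    have "closed_under H id S"
      unfolding closed_under_def
    proof (intro ballI impI subsetI)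
      fix E b assume E: "E \<in> H" "id E \<inter> S \<noteq> {}" "b \<in> id E"
      then obtain a where a: "a \<in> E" "a \<in> S" by auto
      then obtain p where p: "hpath V H p" "hd p = v" "last p = a" unfolding S_def by blast
      have bV: "b \<in> V" using E assms by (auto simp: hypergraph_def)
      show "b \<in> S"
      proof (cases "a = b")
        case False
        then have "hadjacent H a b" using E a by (auto simp: hadjacent_def)
        then have "hpath V H (p @ [b]) \<and> hd (p @ [b]) = v \<and> last (p @ [b]) = b"
          using p bV by (auto simp: hpath_def successively_append_iff)
        then show ?thesis using bV unfolding S_def by blast
      qed (use a in simp)
    qed
    then have "S = V" using fam_connectedD[OF con, of S] vS by (auto simp: S_def)
    then show "\<exists>p. hpath V H p \<and> hd p = v \<and> last p = w" using w by (auto simp: S_def)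
  qed
qed

text \<open>Growing a vertex set by a set \<open>F j\<close> that already meets it costs at most \<open>\<bar>F j\<bar> - 1\<close> new
  vertices.\<close>

lemma fam_connected_card_le:
  assumes "finite V" "finite J" "V \<noteq> {}" and sub: "\<And>j. j \<in> J \<Longrightarrow> F j \<subseteq> V"
    and con: "fam_connected V J F"
  shows "card V \<le> Suc (\<Sum>j\<in>J. card (F j) - 1)"
proof -
  obtain v where v: "v \<in> V" using assms by blast
  \<comment> \<open>Take a largest subfamily \<open>K\<close> whose union with \<open>v\<close> obeys the bound; a set that leaves this union while
    meeting it would enlarge \<open>K\<close>, so the union is closed.\<close>
  define reach where "reach K = insert v (\<Union>j\<in>K. F j)" for K
  define good where "good K \<longleftrightarrow> K \<subseteq> J \<and> card (reach K) \<le> Suc (\<Sum>j\<in>K. card (F j) - 1)" for K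
  have "good {}" by (simp add: good_def reach_def)
  moreover have "card K < Suc (card J)" if "good K" for K
    using that card_mono[OF assms(2), of K] by (auto simp: good_def)
  ultimately obtain K where K: "good K" and max: "\<And>L. good L \<Longrightarrow> card L \<le> card K"
    using ex_has_greatest_nat[of good "{}" card "Suc (card J)"] by (metis less_imp_le)
  have KJ: "K \<subseteq> J" and fK: "finite K" using K assms(2) finite_subset by (auto simp: good_def)
  have RV: "reach K \<subseteq> V" using v sub KJ by (auto simp: reach_def)
  have "closed_under J F (reach K)"
  proof (rule ccontr)
    assume "\<not> closed_under J F (reach K)"
    then obtain j where j: "j \<in> J" "F j \<inter> reach K \<noteq> {}" "\<not> F j \<subseteq> reach K"
      by (auto simp: closed_under_def)
    then have jK: "j \<notin> K" by (auto simp: reach_def)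
    have fin: "finite (F j)" "finite (reach K)"
      using sub[OF j(1)] RV assms(1) finite_subset by blast+
    have pos: "card (F j \<inter> reach K) \<ge> 1" using j(2) fin by (simp add: Suc_leI card_gt_0_iff)
    have "reach (insert j K) = F j \<union> reach K" by (auto simp: reach_def)
    then have "card (reach (insert j K)) + card (F j \<inter> reach K) = card (F j) + card (reach K)"
      using card_Un_Int[OF fin] by simp
    then have "good (insert j K)"
      using K pos j(1) jK fK card_mono[OF fin(1), of "F j \<inter> reach K"]
      by (auto simp: good_def)
    from max[OF this] show False using jK fK by simp
  qed
  then have "reach K = V"
    using fam_connectedD[OF con RV] by (auto simp: reach_def)
  then have "card V \<le> Suc (\<Sum>j\<in>K. card (F j) - 1)" using K by (simp add: good_def)
  also have "\<dots> \<le> Suc (\<Sum>j\<in>J. card (F j) - 1)"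
    using sum_mono2[OF assms(2) KJ, of "\<lambda>j. card (F j) - 1"] by simp
  finally show ?thesis .
qed

text \<open>The rigidity of tight families. The hypothesis on \<open>S\<close> says that \<open>x\<close> and \<open>y\<close> remain linked
  after \<open>x\<close> has been deleted from \<open>F i\<close>. As \<open>y\<close> stays in the shrunken set, \<open>x\<close> is still linked to all of it,
  so the new family is connected, although its sum of \<open>\<bar>F j\<bar> - 1\<close> is too small.\<close>

lemma tight_family_irredundant:
  assumes "finite V" "finite J" "V \<noteq> {}" and sub: "\<And>j. j \<in> J \<Longrightarrow> F j \<subseteq> V"
    and con: "fam_connected V J F"
    and tight: "Suc (\<Sum>j\<in>J. card (F j) - 1) = card V"
    and i: "i \<in> J" "x \<in> F i" "y \<in> F i" "x \<noteq> y"
    and equiv: "\<And>S. closed_under J (F(i := F i - {x})) S \<Longrightarrow> x \<in> S \<longleftrightarrow> y \<in> S"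
  shows False
proof -
  let ?G = "F(i := F i - {x})"
  have fi: "finite (F i)" using sub[OF i(1)] assms(1) finite_subset by blast
  have "fam_connected V J ?G"
    unfolding fam_connected_def
  proof (intro allI impI)
    fix S assume S: "S \<subseteq> V" "S \<noteq> {}" "closed_under J ?G S"
    have "closed_under J F S"
      unfolding closed_under_def
    proof (intro ballI impI)
      fix j assume j: "j \<in> J" "F j \<inter> S \<noteq> {}"
      show "F j \<subseteq> S"
      proof (cases "j = i")
        case True
        have yG: "y \<in> ?G i" using i by simp
        have "y \<in> S"
        proof (cases "x \<in> S")
          case False
          then obtain z where "z \<in> ?G i" "z \<in> S" using j True by auto
          then show ?thesis using closed_underD[OF S(3) i(1) _ _ yG] by blast
        qed (use equiv[OF S(3)] in blast)
        then have "x \<in> S" "?G i \<subseteq> S"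
          using equiv[OF S(3)] closed_underD[OF S(3) i(1) yG] by blast+
        then show ?thesis using True by auto
      next
        case False
        then show ?thesis using S(3) j by (simp add: closed_under_fun_upd) (simp add: closed_under_def)
      qed
    qed
    then show "S = V" using fam_connectedD[OF con S(1,2)] by blast
  qed
  then have "card V \<le> Suc (\<Sum>j\<in>J. card (?G j) - 1)"
    by (rule fam_connected_card_le[OF assms(1-3), rotated]) (use sub in auto)
  moreover have "(\<Sum>j\<in>J. card (?G j) - 1) < (\<Sum>j\<in>J. card (F j) - 1)"
  proof (rule sum_strict_mono_ex1)
    have "card {x, y} \<le> card (F i)" using i fi by (intro card_mono) auto
    then have "card (F i - {x}) - 1 < card (F i) - 1" using i fi by simp
    then show "\<exists>j\<in>J. card (?G j) - 1 < card (F j) - 1" using i(1) by (intro bexI[of _ i]) auto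
    show "\<forall>j\<in>J. card (?G j) - 1 \<le> card (F j) - 1"
      using fi i by (auto intro!: diff_le_mono card_mono)
  qed (use assms in auto)
  ultimately show False using tight by linarith
qed

text \<open>If \<open>F i\<close> and \<open>F j\<close> share \<open>x\<close> and \<open>y\<close>, then \<open>F j\<close> links them after \<open>x\<close> has left \<open>F i\<close>.\<close>

lemma tight_family_linear:
  assumes "finite V" "finite J" "V \<noteq> {}" and "\<And>j. j \<in> J \<Longrightarrow> F j \<subseteq> V"
    and "fam_connected V J F"
    and "Suc (\<Sum>j\<in>J. card (F j) - 1) = card V"
    and i: "i \<in> J" "j \<in> J" "i \<noteq> j"
  shows "card (F i \<inter> F j) \<le> 1"
proof (rule ccontr)
  assume "\<not> card (F i \<inter> F j) \<le> 1"
  moreover have "finite (F i \<inter> F j)" using assms(1,4) i(1) finite_subset by blast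
  ultimately obtain x y where xy: "x \<in> F i \<inter> F j" "y \<in> F i \<inter> F j" "x \<noteq> y"
    using card_le_Suc0_iff_eq[of "F i \<inter> F j"] by auto
  have "x \<in> S \<longleftrightarrow> y \<in> S" if "closed_under J (F(i := F i - {x})) S" for S
    using closed_underD[OF that i(2), of x y] closed_underD[OF that i(2), of y x] xy i(3) by auto
  then show False
    using tight_family_irredundant[OF assms(1-6) i(1), of x y] xy by blast
qed

text \<open>Let \<open>c\<close> be a cycle and \<open>e t\<close> a hyperedge containing its \<open>t\<close>-th step. If two
  successive hyperedges differ, their common cycle vertex can be deleted from the second one: the rest of the cycle
  still links it to its successor, as no other step combines that vertex with that hyperedge. This contradicts rigidity,
  so all \<open>e t\<close> coincide and contain the cycle.\<close>

lemma tight_hypergraph_hypertree_iff: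
  assumes "hypergraph V H" "V \<noteq> {}" and tight: "Suc (\<Sum>E\<in>H. card E - 1) = card V"
  shows "hypertree V H \<longleftrightarrow> fam_connected V H id"
proof
  show "hypertree V H \<Longrightarrow> fam_connected V H id"
    using hconnected_iff_fam_connected[OF assms(1)] by (simp add: hypertree_def)
next
  assume con: "fam_connected V H id"
  have fV: "finite V" and sub: "\<And>E. E \<in> H \<Longrightarrow> id E \<subseteq> V" using assms by (auto simp: hypergraph_def)
  have fH: "finite H" using sub fV by (intro finite_subset[of H "Pow V"]) auto
  have tight': "Suc (\<Sum>E\<in>H. card (id E) - 1) = card V" using tight by simp
  have "\<exists>E\<in>H. set c \<subseteq> E" if c: "hcycle V H c" for c
  proof -
    define m where "m = length (butlast c)"
    have m: "3 \<le> m" and lc: "length c = Suc m" using c by (auto simp: hcycle_def m_def)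
    have dist: "c ! s \<noteq> c ! t" if "s < m" "t < m" "s \<noteq> t" for s t
      using c that nth_eq_iff_index_eq[of "butlast c" s t]
      by (auto simp: hcycle_def m_def nth_butlast)
    have "c \<noteq> []" using lc by auto
    then have wrap: "c ! m = c ! 0" using c lc by (simp add: hcycle_def last_conv_nth hd_conv_nth)
    have "\<exists>E\<in>H. c ! t \<in> E \<and> c ! Suc t \<in> E" if "t < m" for t
      using c that lc by (auto simp: hcycle_def hpath_def hadjacent_def successively_conv_nth)
    then obtain e where e: "\<And>t. t < m \<Longrightarrow> e t \<in> H \<and> c ! t \<in> e t \<and> c ! Suc t \<in> e t"
      by metis
    have "e (Suc t) = e t" if t: "Suc t < m" for t
    proof (rule ccontr)
      assume ne: "e (Suc t) \<noteq> e t"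
      let ?i = "e (Suc t)" and ?x = "c ! Suc t" and ?y = "c ! Suc (Suc t)"
      let ?G = "id(?i := id ?i - {?x})"
      have x_other: "c ! s \<noteq> ?x" if "s \<le> m" "s \<noteq> Suc t" for s
        using that t wrap dist[of s "Suc t"] dist[of 0 "Suc t"] by (cases "s = m") auto
      have "?x \<in> S \<longleftrightarrow> ?y \<in> S" if S: "closed_under H ?G S" for S
      proof -
        have step: "c ! s \<in> S \<longleftrightarrow> c ! Suc s \<in> S" if "s < m" "s \<noteq> Suc t" for s
        proof -
          have "c ! s \<in> ?G (e s)" "c ! Suc s \<in> ?G (e s)"
            using e[OF that(1)] that x_other[of s] x_other[of "Suc s"] ne by auto
          then show ?thesis using closed_underD[OF S] e[OF that(1)] by blast
        qed
        \<comment> \<open>Follow the cycle the long way round: from \<open>?y\<close> forward to the end \<open>c ! m = c ! 0\<close>, then on to \<open>?x\<close>.\<close>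
        have up: "s \<le> Suc t \<Longrightarrow> c ! s \<in> S \<longleftrightarrow> c ! 0 \<in> S" for s
          using t by (induction s) (auto simp: step[symmetric])
        have down: "Suc (Suc t) + s \<le> m \<Longrightarrow> c ! (Suc (Suc t) + s) \<in> S \<longleftrightarrow> ?y \<in> S" for s
          by (induction s) (auto simp: step[symmetric])
        obtain s where s: "m = Suc (Suc t) + s" using t le_Suc_ex[of "Suc (Suc t)" m] by auto
        have "c ! m \<in> S \<longleftrightarrow> ?y \<in> S" using down[of s] unfolding s[symmetric] by simp
        then show ?thesis using up[of "Suc t"] wrap by simp
      qed
      moreover have "?i \<in> H" "?x \<in> id ?i" "?y \<in> id ?i" "?x \<noteq> ?y"
        using e[OF t] x_other[of "Suc (Suc t)"] t by auto
      ultimately show False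
        using tight_family_irredundant[OF fV fH assms(2) sub con tight'] by blast
    qed
    then have e0: "t < m \<Longrightarrow> e t = e 0" for t
    proof (induction t)
      case (Suc t)
      then show ?case by simp
    qed simp
    have "set c \<subseteq> e 0"
    proof
      fix v assume "v \<in> set c"
      then obtain t where t: "t \<le> m" "v = c ! t"
        using lc by (auto simp: in_set_conv_nth less_Suc_eq_le)
      show "v \<in> e 0"
      proof (cases "t = m")
        case True
        then show ?thesis using e[of 0] m t(2) wrap by simp
      next
        case False
        then have "t < m" using t by simp
        then show ?thesis using e[of t] e0[of t] t(2) by simp
      qed
    qed
    moreover have "e 0 \<in> H" using e[of 0] m by simp
    ultimately show ?thesis by blast
  qed
  moreover have "card (E \<inter> F) \<le> 1" if "E \<in> H" "F \<in> H" "E \<noteq> F" for E F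
    using tight_family_linear[OF fV fH assms(2) sub con tight' that] by simp
  ultimately have "hyperforest V H" using assms(1) unfolding hyperforest_def by blast
  then show "hypertree V H"
    using con hconnected_iff_fam_connected[OF assms(1)] by (simp add: hypertree_def)
qed

section \<open>Families of prescribed degrees and sizes\<close>

text \<open>Repeated and one-element sets are admitted so that removing a leaf stays within the class. Degrees and sizes are stored minus one, so
  that a zero of \<open>mu\<close> marks a vertex of degree one and a zero of \<open>lam\<close> a singleton.\<close>

definition families ::
  "'a set \<Rightarrow> 'b set \<Rightarrow> ('a \<Rightarrow> nat) \<Rightarrow> ('b \<Rightarrow> nat) \<Rightarrow> ('b \<Rightarrow> 'a set) set" where
  "families V J mu lam = {F \<in> J \<rightarrow>\<^sub>E Pow V. fam_connected V J F \<and>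
     (\<forall>v\<in>V. card {j \<in> J. v \<in> F j} = Suc (mu v)) \<and> (\<forall>j\<in>J. card (F j) = Suc (lam j))}"

lemma card_one_unique:
  "card {i \<in> J. P i} = 1 \<Longrightarrow> i \<in> J \<Longrightarrow> P i \<Longrightarrow> j \<in> J \<Longrightarrow> P j \<Longrightarrow> i = j"
  by (metis (mono_tags, lifting) card_1_singletonE mem_Collect_eq singletonD)

lemma finite_families: "finite V \<Longrightarrow> finite J \<Longrightarrow> finite (families V J mu lam)"
  unfolding families_def by (rule finite_subset[of _ "J \<rightarrow>\<^sub>E Pow V"]) (auto intro: finite_PiE)

text \<open>Closed sets correspond under \<open>S \<mapsto> S - {x}\<close>: all of \<open>x\<close>'s links pass through \<open>F j\<close>, whose
  other elements remain linked to each other by the shrunken set.\<close>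

lemma fam_connected_remove_vertex:
  assumes x: "x \<in> V" "x \<in> F j" and j: "j \<in> J" and sub: "F j \<subseteq> V" and ne: "F j \<noteq> {x}"
    and only: "\<And>i. i \<in> J \<Longrightarrow> x \<in> F i \<Longrightarrow> i = j"
  shows "fam_connected (V - {x}) J (F(j := F j - {x})) \<longleftrightarrow> fam_connected V J F"
    (is "fam_connected _ J ?G \<longleftrightarrow> _")
proof
  assume con: "fam_connected V J F"
  show "fam_connected (V - {x}) J ?G"
    unfolding fam_connected_def
  proof (intro allI impI)
    fix S assume S: "S \<subseteq> V - {x}" "S \<noteq> {}" "closed_under J ?G S"
    have other: "F i \<subseteq> S" if "i \<in> J" "i \<noteq> j" "F i \<inter> S \<noteq> {}" for i
      using S(3) that by (simp add: closed_under_fun_upd) (simp add: closed_under_def)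
    show "S = V - {x}"
    proof (cases "F j \<inter> S = {}")
      case True
      then have "closed_under J F S" using other by (auto simp: closed_under_def)
      then have "S = V"
        by (rule fam_connectedD[OF con, rotated 2]) (use S(1,2) in auto)
      then show ?thesis using S(1) x(1) by blast
    next
      case False
      then obtain z where "z \<in> F j" "z \<in> S" by blast
      then have "F j - {x} \<subseteq> S" using S j by (auto simp: closed_under_fun_upd)
      then have "closed_under J F (insert x S)"
        unfolding closed_under_def
      proof (intro ballI impI)
        fix i assume i: "i \<in> J" "F i \<inter> insert x S \<noteq> {}"
        show "F i \<subseteq> insert x S"
        proof (cases "i = j")
          case False
          then have "F i \<inter> S \<noteq> {}" using i only[OF i(1)] by auto
          then show ?thesis using other[OF i(1) False] by blast
        qed (use \<open>F j - {x} \<subseteq> S\<close> in blast)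
      qed
      then have "insert x S = V"
        by (rule fam_connectedD[OF con, rotated 2]) (use S(1) x(1) in auto)
      then show ?thesis using S by blast
    qed
  qed
next
  assume con: "fam_connected (V - {x}) J ?G"
  show "fam_connected V J F"
    unfolding fam_connected_def
  proof (intro allI impI)
    fix S assume S: "S \<subseteq> V" "S \<noteq> {}" "closed_under J F S"
    obtain y where y: "y \<in> F j" "y \<noteq> x" using ne x by blast
    have meets: "S - {x} \<noteq> {}"
      using closed_underD[OF S(3) j x(2) _ y(1)] y S(2) by blast
    have "closed_under J ?G (S - {x})"
    proof -
      have "F i \<subseteq> S - {x}" if "i \<in> J - {j}" "F i \<inter> (S - {x}) \<noteq> {}" for i
        using closed_underD[OF S(3), of i] only[of i] that by blast
      moreover have "F j - {x} \<subseteq> S - {x}" if "(F j - {x}) \<inter> (S - {x}) \<noteq> {}"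
        using closed_underD[OF S(3) j] that by blast
      ultimately show ?thesis
        unfolding closed_under_fun_upd closed_under_def by simp
    qed
    then have eq: "S - {x} = V - {x}"
      by (rule fam_connectedD[OF con, rotated 2]) (use S(1) meets in auto)
    then have "y \<in> S" using y sub by blast
    then have "x \<in> S" using closed_underD[OF S(3) j y(1) _ x(2)] by blast
    then show "S = V" using eq x by blast
  qed
qed

lemma families_remove_vertex:
  assumes fin: "finite V" "finite J" and x: "x \<in> V" "mu x = 0" and j: "j \<in> J" "lam j = Suc l"
  shows "card {F \<in> families V J mu lam. x \<in> F j} = card (families (V - {x}) J mu (lam(j := l)))"
proof (rule bij_betw_same_card)
  let ?A = "{F \<in> families V J mu lam. x \<in> F j}"
  let ?B = "families (V - {x}) J mu (lam(j := l))"
  let ?del = "\<lambda>F. F(j := F j - {x})" and ?ins = "\<lambda>G. G(j := insert x (G j))"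
  show "bij_betw ?del ?A ?B"
  proof (rule bij_betw_byWitness[where f' = ?ins])
    show "\<forall>F\<in>?A. ?ins (?del F) = F" by (auto simp: insert_absorb fun_upd_idem)
    have notin: "x \<notin> G i" if "G \<in> ?B" "i \<in> J" for G i
      using that by (auto simp: families_def PiE_def Pi_def)
    show "\<forall>G\<in>?B. ?del (?ins G) = G" using notin j by (auto simp: fun_upd_idem)
    show "?del ` ?A \<subseteq> ?B"
    proof (rule image_subsetI)
      fix F assume F: "F \<in> ?A"
      then have fam: "F \<in> families V J mu lam" and xj: "x \<in> F j" by auto
      have sub: "F i \<subseteq> V" if "i \<in> J" for i using fam that by (auto simp: families_def PiE_def Pi_def)
      have "card {i \<in> J. x \<in> F i} = 1" using fam x by (simp add: families_def)
      then have only: "i \<in> J \<Longrightarrow> x \<in> F i \<Longrightarrow> i = j" for i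
        by (rule card_one_unique) (use xj j in auto)
      have fj: "finite (F j)" using sub[OF j(1)] fin finite_subset by blast
      have cj: "card (F j) = Suc (Suc l)" using fam j by (simp add: families_def)
      then have ne: "F j \<noteq> {x}" by auto
      have "fam_connected (V - {x}) J (?del F) \<longleftrightarrow> fam_connected V J F"
        by (rule fam_connected_remove_vertex[where F = F, OF x(1) xj j(1) sub[OF j(1)] ne]) (rule only)
      then have con: "fam_connected (V - {x}) J (?del F)" using fam by (simp add: families_def)
      have "{i \<in> J. v \<in> ?del F i} = {i \<in> J. v \<in> F i}" if "v \<noteq> x" for v using that by auto
      moreover have "?del F \<in> J \<rightarrow>\<^sub>E Pow (V - {x})"
      proof (rule PiE_I)
        show "?del F i \<in> Pow (V - {x})" if "i \<in> J" for i
          using sub[OF that] only[OF that] by auto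
        show "?del F i = undefined" if "i \<notin> J" for i
          using fam j that by (auto simp: families_def PiE_iff extensional_def)
      qed
      ultimately show "?del F \<in> ?B"
        using fam con cj fj xj by (auto simp: families_def)
    qed
    show "?ins ` ?B \<subseteq> ?A"
    proof (rule image_subsetI)
      fix G assume G: "G \<in> ?B"
      let ?F = "?ins G"
      have sub: "G i \<subseteq> V - {x}" if "i \<in> J" for i
        using G that by (auto simp: families_def PiE_def Pi_def)
      have fj: "finite (G j)" using sub[OF j(1)] fin finite_subset by blast
      have cj: "card (G j) = Suc l" using G j by (simp add: families_def)
      then have ne: "?F j \<noteq> {x}" using notin[OF G j(1)] by (metis card.empty fun_upd_same insert_ident empty_iff nat.distinct(1))
      have del: "?F(j := ?F j - {x}) = G" using notin[OF G j(1)] by (simp add: fun_upd_idem)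
      have only: "i \<in> J \<Longrightarrow> x \<in> ?F i \<Longrightarrow> i = j" for i using notin[OF G] by (auto split: if_splits)
      have Fj: "x \<in> ?F j" "?F j \<subseteq> V" using sub[OF j(1)] x by auto
      have "fam_connected (V - {x}) J (?F(j := ?F j - {x})) \<longleftrightarrow> fam_connected V J ?F"
        by (rule fam_connected_remove_vertex[where F = "?ins G", OF x(1) Fj(1) j(1) Fj(2) ne]) (rule only)
      then have con: "fam_connected V J ?F" unfolding del using G by (simp add: families_def)
      have same: "{i \<in> J. v \<in> ?F i} = {i \<in> J. v \<in> G i}" if "v \<noteq> x" for v using that by auto
      have new: "{i \<in> J. x \<in> ?F i} = {j}" using only j by auto
      have "card {i \<in> J. v \<in> ?F i} = Suc (mu v)" if "v \<in> V" for v
      proof (cases "v = x")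
        case True
        then show ?thesis unfolding True new using x by simp
      next
        case False
        then show ?thesis using G that unfolding same[OF False] by (simp add: families_def)
      qed
      moreover have "?F \<in> J \<rightarrow>\<^sub>E Pow V"
        using G j x by (auto simp: families_def PiE_iff extensional_def)
      moreover have "\<forall>i\<in>J. card (?F i) = Suc (lam i)"
        using G cj fj j notin[OF G j(1)] by (auto simp: families_def)
      ultimately show "?F \<in> ?A" using con by (auto simp: families_def)
    qed
  qed
qed

text \<open>Nothing links \<open>x\<close> to another vertex, so \<open>{x}\<close> is closed.\<close>

lemma degree_one_vertex_in_singleton:
  assumes F: "F \<in> families V J mu lam" and "x \<in> V" "mu x = 0" "j \<in> J" "F j = {x}"
  shows "V = {x}"
proof -
  have "card {i \<in> J. x \<in> F i} = 1" using F assms by (simp add: families_def)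
  then have "i \<in> J \<Longrightarrow> x \<in> F i \<Longrightarrow> i = j" for i
    by (rule card_one_unique) (use assms in auto)
  then have "closed_under J F {x}" using assms(5) by (fastforce simp: closed_under_def)
  then show ?thesis using F assms(2) fam_connectedD[of V J F "{x}"] by (auto simp: families_def)
qed

text \<open>A singleton links nothing, so it can be discarded without affecting connectedness; only the degree of
  its element drops.\<close>

lemma families_remove_edge:
  assumes fin: "finite V" "finite J" and j: "j \<in> J" "lam j = 0" and v: "v \<in> V" "mu v = Suc m"
  shows "card {F \<in> families V J mu lam. F j = {v}} = card (families V (J - {j}) (mu(v := m)) lam)"
proof (rule bij_betw_same_card)
  let ?A = "{F \<in> families V J mu lam. F j = {v}}"
  let ?B = "families V (J - {j}) (mu(v := m)) lam"
  \<comment> \<open>Extensional functions take the value \<open>undefined\<close> outside their index set.\<close>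
  let ?del = "\<lambda>F. F(j := undefined)" and ?ins = "\<lambda>G. G(j := {v})"
  have con: "fam_connected V (J - {j}) G \<longleftrightarrow> fam_connected V J F"
    if "F j = {v}" "\<And>i. i \<noteq> j \<Longrightarrow> F i = G i" for F G
  proof -
    have "closed_under J F S \<longleftrightarrow> closed_under (J - {j}) G S" for S
    proof -
      have "closed_under J F S \<longleftrightarrow> closed_under (J - {j}) F S"
        using that(1) j unfolding closed_under_def by auto
      also have "\<dots> \<longleftrightarrow> closed_under (J - {j}) G S"
        using that(2) unfolding closed_under_def by simp
      finally show ?thesis .
    qed
    then show ?thesis by (simp add: fam_connected_def)
  qed
  have deg_v: "card {i \<in> J. v \<in> F i} = Suc (card {i \<in> J - {j}. v \<in> G i})"
    if "F j = {v}" "\<And>i. i \<noteq> j \<Longrightarrow> F i = G i" for F G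
  proof -
    have "i \<in> J \<and> v \<in> F i \<longleftrightarrow> i = j \<or> i \<in> J - {j} \<and> v \<in> G i" for i
      using that(1) that(2)[of i] j by (cases "i = j") auto
    then have "{i \<in> J. v \<in> F i} = insert j {i \<in> J - {j}. v \<in> G i}" by blast
    then show ?thesis using fin by simp
  qed
  have deg: "{i \<in> J. u \<in> F i} = {i \<in> J - {j}. u \<in> G i}"
    if "F j = {v}" "\<And>i. i \<noteq> j \<Longrightarrow> F i = G i" "u \<noteq> v" for F G u
  proof -
    have "i \<in> J \<and> u \<in> F i \<longleftrightarrow> i \<in> J - {j} \<and> u \<in> G i" for i
      using that(1,3) that(2)[of i] by (cases "i = j") auto
    then show ?thesis by blast
  qed
  show "bij_betw ?del ?A ?B"
  proof (rule bij_betw_byWitness[where f' = ?ins])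
    show "\<forall>F\<in>?A. ?ins (?del F) = F" by (auto simp: fun_upd_idem)
    show "\<forall>G\<in>?B. ?del (?ins G) = G"
      by (auto simp: families_def PiE_iff extensional_def fun_upd_idem)
    show "?del ` ?A \<subseteq> ?B"
    proof (rule image_subsetI)
      fix F assume F: "F \<in> ?A"
      then have Fj: "F j = {v}" by simp
      have "?del F \<in> (J - {j}) \<rightarrow>\<^sub>E Pow V" using F by (auto simp: families_def PiE_iff extensional_def)
      moreover have "card {i \<in> J - {j}. u \<in> ?del F i} = Suc ((mu(v := m)) u)" if "u \<in> V" for u
      proof (cases "u = v")
        case True
        have "Suc (card {i \<in> J - {j}. v \<in> ?del F i}) = card {i \<in> J. v \<in> F i}"
          by (rule deg_v[symmetric]) (use Fj in auto)
        then show ?thesis using True F v by (simp add: families_def)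
      next
        case False
        have "{i \<in> J - {j}. u \<in> ?del F i} = {i \<in> J. u \<in> F i}"
          by (rule deg[symmetric]) (use Fj False in auto)
        then show ?thesis using False F that by (simp add: families_def)
      qed
      moreover have "fam_connected V (J - {j}) (?del F)"
        using con[of F "?del F"] F by (simp add: families_def)
      ultimately show "?del F \<in> ?B" using F by (auto simp: families_def)
    qed
    show "?ins ` ?B \<subseteq> ?A"
    proof (rule image_subsetI)
      fix G assume G: "G \<in> ?B"
      have Fj: "?ins G j = {v}" by simp
      have "?ins G \<in> J \<rightarrow>\<^sub>E Pow V" using G v j by (auto simp: families_def PiE_iff extensional_def)
      moreover have "\<forall>u\<in>V. card {i \<in> J. u \<in> ?ins G i} = Suc (mu u)"
      proof
        fix u assume u: "u \<in> V"
        show "card {i \<in> J. u \<in> ?ins G i} = Suc (mu u)"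
        proof (cases "u = v")
          case True
          have "card {i \<in> J. v \<in> ?ins G i} = Suc (card {i \<in> J - {j}. v \<in> G i})"
            by (rule deg_v) auto
          then show ?thesis using True G v by (simp add: families_def del: fun_upd_apply) simp
        next
          case False
          have "{i \<in> J. u \<in> ?ins G i} = {i \<in> J - {j}. u \<in> G i}"
            by (rule deg) (use False in auto)
          then show ?thesis using False G u by (simp add: families_def del: fun_upd_apply) simp
        qed
      qed
      ultimately show "?ins G \<in> ?A"
        using G j con[of "?ins G" G, OF Fj] by (auto simp: families_def)
    qed
  qed
qed

lemma prod_fact_upd:
  assumes "finite A" "a \<in> A" "f a = Suc m"
  shows "(\<Prod>i\<in>A. fact (f i) :: nat) = f a * (\<Prod>i\<in>A. fact ((f(a := m)) i))"
proof -
  have "(\<Prod>i\<in>A - {a}. fact (f i) :: nat) = (\<Prod>i\<in>A - {a}. fact ((f(a := m)) i))"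
    by (rule prod.cong) auto
  then show ?thesis using assms
    by (simp add: prod.remove[of A a "\<lambda>i. fact (f i)"] prod.remove[of A a "\<lambda>i. fact ((f(a := m)) i)"]
        algebra_simps del: fun_upd_apply) (simp add: algebra_simps)
qed

lemma sum_upd_pred:
  assumes "finite A" "a \<in> A" "f a = Suc m"
  shows "(\<Sum>i\<in>A. f i) = Suc (\<Sum>i\<in>A. (f(a := m)) i)"
proof -
  have "(\<Sum>i\<in>A - {a}. f i :: nat) = (\<Sum>i\<in>A - {a}. (f(a := m)) i)"
    by (rule sum.cong) auto
  then show ?thesis using assms
    by (simp add: sum.remove[of A a f] sum.remove[of A a "f(a := m)"] del: fun_upd_apply)
       simp
qed

lemma sum_less_card_imp_zero:
  assumes "finite A" "(\<Sum>a\<in>A. f a) < card A"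
  shows "\<exists>a\<in>A. f a = (0::nat)"
proof (rule ccontr)
  assume "\<not> ?thesis"
  then have "(\<Sum>a\<in>A. 1) \<le> (\<Sum>a\<in>A. f a)" by (intro sum_mono) (auto simp: Suc_le_eq)
  then show False using assms by simp
qed

text \<open>Both leaf removals give equations of the form \<open>t\<^sub>j \<cdot> P = lam j \<cdot> Q\<close> (resp. \<open>t\<^sub>v \<cdot> P = mu v \<cdot> Q\<close>), where
  \<open>P\<close> is the product of factorials and \<open>t\<close> counts the families in which the removed leaf hangs on \<open>j\<close> (resp. \<open>v\<close>);
  summing over the place where it hangs replaces the first factor by \<open>\<bar>V\<bar> - 1\<close> (resp. \<open>\<bar>J\<bar> - 1\<close>)
  and completes the factorial. Stating the result without divisions keeps the induction in the natural numbers.\<close>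

lemma card_families:
  assumes "finite V" "finite J" "Suc (\<Sum>v\<in>V. mu v) = card J" "Suc (\<Sum>j\<in>J. lam j) = card V"
  shows "card (families V J mu lam) * ((\<Prod>j\<in>J. fact (lam j)) * (\<Prod>v\<in>V. fact (mu v)))
    = fact (card V - 1) * fact (card J - 1)"
  using assms
proof (induction "card V + card J" arbitrary: V J mu lam rule: less_induct)
  case less
  note fin = less.prems(1,2) and summu = less.prems(3) and sumlam = less.prems(4)
  let ?T = "families V J mu lam"
  let ?P = "(\<Prod>j\<in>J. fact (lam j)) * (\<Prod>v\<in>V. fact (mu v)) :: nat"
  have fT: "finite ?T" using finite_families fin by blast
  consider "card V = 1" | "card V \<noteq> 1" "\<exists>x\<in>V. mu x = 0" | "card V \<noteq> 1" "\<not> (\<exists>x\<in>V. mu x = 0)"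
    by blast
  then show ?case
  proof cases
    case 1
    then obtain v where V: "V = {v}" by (auto simp: card_1_singleton_iff)
    have lam0: "lam j = 0" if "j \<in> J" for j using sumlam 1 fin that by simp
    have "?T = {\<lambda>j\<in>J. {v}}"
    proof (intro equalityI subsetI)
      fix F assume F: "F \<in> ?T"
      have "F j = {v}" if "j \<in> J" for j
      proof -
        have "F j \<subseteq> {v}" "card (F j) = 1"
          using F that lam0 V by (auto simp: families_def PiE_iff)
        then show ?thesis by (metis card.empty subset_singletonD zero_neq_one)
      qed
      then have "F = (\<lambda>j\<in>J. {v})" using F by (auto simp: families_def PiE_iff extensional_def fun_eq_iff)
      then show "F \<in> {\<lambda>j\<in>J. {v}}" by simp
    next
      fix F assume "F \<in> {\<lambda>j\<in>J. {v}}"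
      moreover have "fam_connected V J (\<lambda>j\<in>J. {v})" using V by (auto simp: fam_connected_def)
      moreover have "{j \<in> J. v \<in> (\<lambda>j\<in>J. {v}) j} = J" by auto
      ultimately show "F \<in> ?T" using V lam0 summu by (auto simp: families_def)
    qed
    then show ?thesis using V lam0 summu[symmetric] by simp
  next
    case 2
    then obtain x where x: "x \<in> V" "mu x = 0" by blast
    have V2: "card V = Suc (Suc (card V - 2))" using 2(1) sumlam by simp
    let ?Q = "fact (card V - 2) * fact (card J - 1) :: nat"
    have part: "card {F \<in> ?T. x \<in> F j} * ?P = lam j * ?Q" if j: "j \<in> J" for j
    proof (cases "lam j")
      case 0
      have False if F: "F \<in> ?T" "x \<in> F j" for F
      proof -
        have "card (F j) = 1" using F j 0 by (simp add: families_def)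
        then have "F j = {x}" using F(2) by (auto simp: card_1_singleton_iff)
        then show False using degree_one_vertex_in_singleton[OF F(1) x j] 2(1) by simp
      qed
      then have "{F \<in> ?T. x \<in> F j} = {}" by blast
      then show ?thesis using 0 by (simp only: card.empty mult_0)
    next
      case (Suc l)
      let ?lam = "lam(j := l)"
      have "card (families (V - {x}) J mu ?lam) * ((\<Prod>i\<in>J. fact (?lam i)) * (\<Prod>v\<in>V - {x}. fact (mu v)))
          = fact (card (V - {x}) - 1) * fact (card J - 1)"
      proof (rule less.hyps)
        show "card (V - {x}) + card J < card V + card J"
          using card_Diff1_less[OF fin(1) x(1)] by simp
        show "Suc (\<Sum>v\<in>V - {x}. mu v) = card J" using summu x fin by (simp add: sum.remove[of V x])
        show "Suc (\<Sum>i\<in>J. ?lam i) = card (V - {x})"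
          using sumlam x fin sum_upd_pred[of J j lam l] j Suc by simp
      qed (use fin in auto)
      then have IH: "card (families (V - {x}) J mu ?lam) * ((\<Prod>i\<in>J. fact (?lam i)) * (\<Prod>v\<in>V - {x}. fact (mu v))) = ?Q"
        using x fin by (simp add: numeral_2_eq_2 del: fun_upd_apply)
      have dropx: "(\<Prod>v\<in>V. fact (mu v) :: nat) = (\<Prod>v\<in>V - {x}. fact (mu v))"
        using x fin by (simp add: prod.remove[of V x])
      have pred: "(\<Prod>i\<in>J. fact (lam i) :: nat) = lam j * (\<Prod>i\<in>J. fact (?lam i))"
        by (rule prod_fact_upd) (use fin j Suc in auto)
      have "card {F \<in> ?T. x \<in> F j} * ?P = lam j * (card (families (V - {x}) J mu ?lam) *
          ((\<Prod>i\<in>J. fact (?lam i)) * (\<Prod>v\<in>V - {x}. fact (mu v))))"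
        unfolding families_remove_vertex[where mu = mu and lam = lam, OF fin x j Suc] dropx pred by (simp only: mult_ac)
      then show ?thesis by (simp only: IH)
    qed
    have "?T = (\<Union>j\<in>J. {F \<in> ?T. x \<in> F j})"
    proof -
      have "\<exists>j\<in>J. x \<in> F j" if "F \<in> ?T" for F
      proof -
        have "card {j \<in> J. x \<in> F j} \<noteq> 0" using that x by (simp add: families_def)
        then show ?thesis by (metis (no_types, lifting) Collect_empty_eq card.empty)
      qed
      then show ?thesis by auto
    qed
    moreover have "card (\<Union>j\<in>J. {F \<in> ?T. x \<in> F j}) = (\<Sum>j\<in>J. card {F \<in> ?T. x \<in> F j})"
    proof (rule card_UN_disjoint)
      have "i = j" if "F \<in> ?T" "x \<in> F i" "x \<in> F j" "i \<in> J" "j \<in> J" for F i j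
      proof -
        have "card {j \<in> J. x \<in> F j} = 1" using that x by (simp add: families_def)
        then show ?thesis by (rule card_one_unique) (use that in auto)
      qed
      then show "\<forall>i\<in>J. \<forall>j\<in>J. i \<noteq> j \<longrightarrow> {F \<in> ?T. x \<in> F i} \<inter> {F \<in> ?T. x \<in> F j} = {}" by blast
    qed (use fin fT in auto)
    ultimately have "card ?T * ?P = (\<Sum>j\<in>J. card {F \<in> ?T. x \<in> F j} * ?P)"
      by (simp add: sum_distrib_right)
    also have "\<dots> = (\<Sum>j\<in>J. lam j) * ?Q" using part by (simp add: sum_distrib_right)
    also have "(\<Sum>j\<in>J. lam j) = Suc (card V - 2)" using sumlam V2 by simp
    also have "Suc (card V - 2) * ?Q = fact (Suc (card V - 2)) * fact (card J - 1)"
      by (simp only: fact_Suc mult.assoc of_nat_id)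
    also have "Suc (card V - 2) = card V - 1" using V2 by simp
    finally show ?thesis .
  next
    case 3
    have "\<not> (\<Sum>v\<in>V. mu v) < card V" using sum_less_card_imp_zero[OF fin(1)] 3(2) by blast
    then have big: "card V < card J" using summu by simp
    then obtain j where j: "j \<in> J" "lam j = 0"
      using sum_less_card_imp_zero[OF fin(2), of lam] sumlam by auto
    have J2: "card J = Suc (Suc (card J - 2))" using big sumlam by simp
    let ?Q = "fact (card V - 1) * fact (card J - 2) :: nat"
    have part: "card {F \<in> ?T. F j = {v}} * ?P = mu v * ?Q" if v: "v \<in> V" for v
    proof -
      obtain m where m: "mu v = Suc m" using 3(2) v by (cases "mu v") auto
      let ?mu = "mu(v := m)"
      have "card (families V (J - {j}) ?mu lam) * ((\<Prod>i\<in>J - {j}. fact (lam i)) * (\<Prod>u\<in>V. fact (?mu u)))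
          = fact (card V - 1) * fact (card (J - {j}) - 1)"
      proof (rule less.hyps)
        show "card V + card (J - {j}) < card V + card J"
          using card_Diff1_less[OF fin(2) j(1)] by simp
        show "Suc (\<Sum>i\<in>J - {j}. lam i) = card V" using sumlam j fin by (simp add: sum.remove[of J j])
        show "Suc (\<Sum>u\<in>V. ?mu u) = card (J - {j})"
          using summu j fin sum_upd_pred[of V v mu m] v m by simp
      qed (use fin in auto)
      then have IH: "card (families V (J - {j}) ?mu lam) * ((\<Prod>i\<in>J - {j}. fact (lam i)) * (\<Prod>u\<in>V. fact (?mu u))) = ?Q"
        using j fin by (simp add: numeral_2_eq_2 del: fun_upd_apply)
      have dropj: "(\<Prod>i\<in>J. fact (lam i) :: nat) = (\<Prod>i\<in>J - {j}. fact (lam i))"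
        using j fin by (simp add: prod.remove[of J j])
      have pred: "(\<Prod>u\<in>V. fact (mu u) :: nat) = mu v * (\<Prod>u\<in>V. fact (?mu u))"
        by (rule prod_fact_upd) (use fin v m in auto)
      have "card {F \<in> ?T. F j = {v}} * ?P = mu v * (card (families V (J - {j}) ?mu lam) *
          ((\<Prod>i\<in>J - {j}. fact (lam i)) * (\<Prod>u\<in>V. fact (?mu u))))"
        unfolding families_remove_edge[where mu = mu and lam = lam, OF fin j v m] dropj pred by (simp only: mult_ac)
      then show ?thesis by (simp only: IH)
    qed
    have "?T = (\<Union>v\<in>V. {F \<in> ?T. F j = {v}})"
    proof -
      have "\<exists>v\<in>V. F j = {v}" if "F \<in> ?T" for F
      proof -
        have "card (F j) = 1" "F j \<subseteq> V" using that j by (auto simp: families_def PiE_iff)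
        then show ?thesis by (auto simp: card_1_singleton_iff)
      qed
      then show ?thesis by auto
    qed
    moreover have "card (\<Union>v\<in>V. {F \<in> ?T. F j = {v}}) = (\<Sum>v\<in>V. card {F \<in> ?T. F j = {v}})"
      by (rule card_UN_disjoint) (use fin fT in auto)
    ultimately have "card ?T * ?P = (\<Sum>v\<in>V. card {F \<in> ?T. F j = {v}} * ?P)"
      by (simp add: sum_distrib_right)
    also have "\<dots> = (\<Sum>v\<in>V. mu v) * ?Q" using part by (simp add: sum_distrib_right)
    also have "(\<Sum>v\<in>V. mu v) = Suc (card J - 2)" using summu J2 by simp
    also have "Suc (card J - 2) * ?Q = fact (card V - 1) * fact (Suc (card J - 2))"
      by (simp only: fact_Suc mult.left_commute of_nat_id)
    also have "Suc (card J - 2) = card J - 1" using J2 by simp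
    finally show ?thesis .
  qed
qed

section \<open>Forgetting the labels of the hyperedges\<close>

lemma count_image_mset_set_eq_card:
  "finite A \<Longrightarrow> count (image_mset f (mset_set A)) c = card {x \<in> A. f x = c}"
  by (simp add: count_image_mset' Int_def sum.inter_filter[symmetric] conj_commute eq_commute
      flip: card_eq_sum)

text \<open>Induction on \<open>J\<close>: a new index \<open>i\<close> may be sent to any element of its colour, and the number of those
  is the multiplicity of the colour of \<open>i\<close> after its insertion, which is the quotient of the two factorials.\<close>

lemma card_colour_preserving_bijections:
  fixes a :: "'b \<Rightarrow> 'd" and b :: "'c \<Rightarrow> 'd"
  assumes "finite J" "finite H" "image_mset a (mset_set J) = image_mset b (mset_set H)"
    and "finite C" "a ` J \<subseteq> C"
  shows "card {g \<in> J \<rightarrow>\<^sub>E H. bij_betw g J H \<and> (\<forall>j\<in>J. b (g j) = a j)}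
    = (\<Prod>c\<in>C. fact (card {j \<in> J. a j = c}))"
  using assms(1,2,3,5)
proof (induction J arbitrary: H rule: finite_induct)
  case empty
  then have "H = {}" by (simp add: mset_set_empty_iff)
  then have "{g \<in> {} \<rightarrow>\<^sub>E H. bij_betw g {} H \<and> (\<forall>j\<in>{}. b (g j) = a j)} = {\<lambda>x. undefined}"
    by (auto simp: bij_betw_def)
  then show ?case by simp
next
  case (insert i J)
  let ?bij = "\<lambda>J H. {g \<in> J \<rightarrow>\<^sub>E H. bij_betw g J H \<and> (\<forall>j\<in>J. b (g j) = a j)}"
  let ?K = "{h \<in> H. b h = a i}"
  let ?N = "\<Prod>c\<in>C. fact (card {j \<in> J. a j = c}) :: nat"
  have part: "card {g \<in> ?bij (insert i J) H. g i = h} = ?N" if h: "h \<in> ?K" for h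
  proof -
    have "bij_betw (\<lambda>g. g(i := undefined)) {g \<in> ?bij (insert i J) H. g i = h} (?bij J (H - {h}))"
    proof (rule bij_betw_byWitness[where f' = "\<lambda>g. g(i := h)"])
      show "\<forall>g\<in>{g \<in> ?bij (insert i J) H. g i = h}. g(i := undefined, i := h) = g"
        by (auto simp: fun_upd_idem)
      show "\<forall>g\<in>?bij J (H - {h}). g(i := h, i := undefined) = g"
        using insert.hyps(2) by (auto simp: PiE_iff extensional_def fun_upd_idem)
      show "(\<lambda>g. g(i := undefined)) ` {g \<in> ?bij (insert i J) H. g i = h} \<subseteq> ?bij J (H - {h})"
      proof (rule image_subsetI)
        fix g assume g: "g \<in> {g \<in> ?bij (insert i J) H. g i = h}"
        then have "bij_betw g (insert i J - {i}) (H - {h})"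
          by (intro bij_betw_DiffI) auto
        then have "bij_betw g J (H - {h})" using insert.hyps(2) by simp
        then have bij: "bij_betw (g(i := undefined)) J (H - {h})"
          by (rule bij_betw_cong[THEN iffD1, rotated]) (use insert.hyps(2) in auto)
        then have "g(i := undefined) \<in> J \<rightarrow>\<^sub>E (H - {h})"
          using g by (auto simp: PiE_iff extensional_def bij_betw_def)
        then show "g(i := undefined) \<in> ?bij J (H - {h})"
          using g bij insert.hyps(2) by auto
      qed
      show "(\<lambda>g. g(i := h)) ` ?bij J (H - {h}) \<subseteq> {g \<in> ?bij (insert i J) H. g i = h}"
      proof (rule image_subsetI)
        fix g assume g: "g \<in> ?bij J (H - {h})"
        then have "bij_betw (g(i := h)) J (H - {h})"
          by (intro bij_betw_cong[THEN iffD1, of J g "g(i := h)"]) (use insert.hyps(2) in auto)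
        then have "bij_betw (g(i := h)) (insert i J) (insert ((g(i := h)) i) (H - {h}))"
          using insert.hyps(2) by (intro notIn_Un_bij_betw[of i J, simplified]) auto
        then have "bij_betw (g(i := h)) (insert i J) H" using h by (simp add: insert_absorb)
        moreover have "g(i := h) \<in> insert i J \<rightarrow>\<^sub>E H"
          using g h by (auto simp: PiE_iff extensional_def)
        ultimately show "g(i := h) \<in> {g \<in> ?bij (insert i J) H. g i = h}"
          using g h insert.hyps(2) by auto
      qed
    qed
    then have "card {g \<in> ?bij (insert i J) H. g i = h} = card (?bij J (H - {h}))"
      by (rule bij_betw_same_card)
    also have "\<dots> = ?N"
    proof (rule insert.IH)
      have "mset_set H = add_mset h (mset_set (H - {h}))"
        using h insert.prems(1) by (simp add: mset_set.remove)
      then show "image_mset a (mset_set J) = image_mset b (mset_set (H - {h}))"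
        using insert.prems(2) insert.hyps h by simp
    qed (use insert.prems in auto)
    finally show ?thesis .
  qed
  have cK: "card ?K = Suc (card {j \<in> J. a j = a i})"
  proof -
    have "card ?K = count (image_mset b (mset_set H)) (a i)"
      using insert.prems(1) by (simp only: count_image_mset_set_eq_card)
    also have "\<dots> = count (image_mset a (mset_set (insert i J))) (a i)"
      by (simp only: insert.prems(2))
    also have "\<dots> = card {j \<in> insert i J. a j = a i}"
      using insert.hyps by (simp only: count_image_mset_set_eq_card finite_insert)
    also have "{j \<in> insert i J. a j = a i} = insert i {j \<in> J. a j = a i}" by auto
    finally show ?thesis using insert.hyps by simp
  qed
  have fB: "finite (?bij (insert i J) H)"
    by (rule finite_subset[of _ "insert i J \<rightarrow>\<^sub>E H"])
       (use insert in \<open>auto intro!: finite_PiE simp del: PiE_insert_eq\<close>)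
  have "?bij (insert i J) H = (\<Union>h\<in>?K. {g \<in> ?bij (insert i J) H. g i = h})"
    by (auto simp del: PiE_insert_eq)
  also have "card \<dots> = (\<Sum>h\<in>?K. card {g \<in> ?bij (insert i J) H. g i = h})"
  proof (rule card_UN_disjoint)
    show "\<forall>h\<in>?K. finite {g \<in> ?bij (insert i J) H. g i = h}"
      by (intro ballI finite_subset[OF _ fB]) blast
  qed (use insert.prems in auto)
  also have "\<dots> = card ?K * ?N" using part by simp
  also have "\<dots> = (\<Prod>c\<in>C. fact (card {j \<in> insert i J. a j = c}))"
  proof -
    have iC: "a i \<in> C" using insert.prems by simp
    have "{j \<in> insert i J. a j = a i} = insert i {j \<in> J. a j = a i}" by auto
    then have one: "card {j \<in> insert i J. a j = a i} = Suc (card {j \<in> J. a j = a i})"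
      using insert.hyps by simp
    have "{j \<in> insert i J. a j = c} = {j \<in> J. a j = c}" if "c \<noteq> a i" for c using that by auto
    then have rest: "(\<Prod>c\<in>C - {a i}. fact (card {j \<in> insert i J. a j = c}) :: nat)
        = (\<Prod>c\<in>C - {a i}. fact (card {j \<in> J. a j = c}))"
      by (intro prod.cong) auto
    show ?thesis
      unfolding cK prod.remove[OF assms(4) iC] one rest by (simp add: algebra_simps)
  qed
  finally show ?case .
qed

lemma relabel_family:
  assumes "bij_betw F J H"
  shows "fam_connected V H id \<longleftrightarrow> fam_connected V J F"
    and "hdegree H v = card {j \<in> J. v \<in> F j}"
proof -
  have H: "H = F ` J" and inj: "inj_on F J" using assms by (auto simp: bij_betw_def)
  have "closed_under H id S \<longleftrightarrow> closed_under J F S" for S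
    unfolding H closed_under_def by simp
  then show "fam_connected V H id \<longleftrightarrow> fam_connected V J F" by (simp add: fam_connected_def)
  have "{E \<in> H. v \<in> E} = F ` {j \<in> J. v \<in> F j}" unfolding H by blast
  then show "hdegree H v = card {j \<in> J. v \<in> F j}"
    unfolding hdegree_def by (simp add: card_image inj_on_subset[OF inj])
qed

text \<open>The families whose set of members is \<open>H\<close> are the size-preserving bijections from \<open>J\<close> to \<open>H\<close>:
  by \<open>tight_family_linear\<close> two equal members with distinct indices would have only one element, which \<open>lam j \<ge> 1\<close> excludes.\<close>

lemma card_hypertrees_relabelled:
  fixes V :: "'a set" and J :: "'b set"
  assumes fin: "finite V" "finite J" and "V \<noteq> {}"
    and tight: "Suc (\<Sum>j\<in>J. lam j) = card V"
    and pos: "\<And>j. j \<in> J \<Longrightarrow> 1 \<le> lam j"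
    and C: "finite C" "lam ` J \<subseteq> C"
  shows "card {H. hypertree V H \<and> (\<forall>v\<in>V. hdegree H v = 1 + mu v) \<and> card H = card J \<and>
      image_mset card (mset_set H) = image_mset (\<lambda>j. 1 + lam j) (mset_set J)}
    * (\<Prod>c\<in>C. fact (card {j \<in> J. lam j = c})) = card (families V J mu lam)"
    (is "card ?A * ?N = _")
proof -
  let ?fib = "\<lambda>H. {F \<in> J \<rightarrow>\<^sub>E H. bij_betw F J H \<and> (\<forall>j\<in>J. card (F j) = 1 + lam j)}"
  have sub: "H \<subseteq> Pow V" if "H \<in> ?A" for H
    using that by (auto simp: hypertree_def hyperforest_def hypergraph_def)
  have finH: "finite H" if "H \<in> ?A" for H
    by (rule finite_subset[OF sub[OF that]]) (use fin in simp)
  have fib: "card (?fib H) = ?N" if H: "H \<in> ?A" for H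
  proof -
    have "card (?fib H) = (\<Prod>c\<in>Suc ` C. fact (card {j \<in> J. 1 + lam j = c}))"
      by (intro card_colour_preserving_bijections) (use H finH[OF H] fin C in auto)
    also have "\<dots> = ?N" by (simp add: prod.reindex)
    finally show ?thesis .
  qed
  have "families V J mu lam = (\<Union>H\<in>?A. ?fib H)"
  proof (intro equalityI subsetI)
    fix F assume F: "F \<in> families V J mu lam"
    let ?H = "F ` J"
    have FV: "F j \<subseteq> V" and cF: "card (F j) = Suc (lam j)" if "j \<in> J" for j
      using F that by (auto simp: families_def PiE_iff)
    have con: "fam_connected V J F" using F by (simp add: families_def)
    have tightF: "Suc (\<Sum>j\<in>J. card (F j) - 1) = card V" using tight cF by simp
    have inj: "inj_on F J"
    proof (rule inj_onI, rule ccontr)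
      fix i j assume ij: "i \<in> J" "j \<in> J" "F i = F j" "i \<noteq> j"
      have "card (F i \<inter> F j) \<le> 1"
        by (rule tight_family_linear[OF fin assms(3) FV con tightF]) (use ij in auto)
      then show False using ij(3) cF[OF ij(1)] cF[OF ij(2)] pos[OF ij(1)] by simp
    qed
    then have bij: "bij_betw F J ?H" by (simp add: bij_betw_def)
    have hyp: "hypergraph V ?H" using fin FV cF pos by (auto simp: hypergraph_def)
    have "Suc (\<Sum>E\<in>?H. card E - 1) = card V" using tightF inj by (simp add: sum.reindex)
    then have "hypertree V ?H"
      using tight_hypergraph_hypertree_iff[OF hyp assms(3)] relabel_family(1)[OF bij] con by blast
    moreover have "image_mset card (mset_set ?H) = image_mset (\<lambda>j. 1 + lam j) (mset_set J)"
    proof -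
      have "image_mset card (mset_set ?H) = image_mset (\<lambda>j. card (F j)) (mset_set J)"
        by (simp add: image_mset_mset_set[OF inj, symmetric] image_mset.compositionality comp_def)
      also have "\<dots> = image_mset (\<lambda>j. 1 + lam j) (mset_set J)"
        by (rule image_mset_cong) (use fin cF in simp)
      finally show ?thesis .
    qed
    ultimately have "?H \<in> ?A"
      using F relabel_family(2)[OF bij] card_image[OF inj] by (simp add: families_def)
    moreover have "F \<in> ?fib ?H"
      using F bij cF by (auto simp: families_def PiE_iff)
    ultimately show "F \<in> (\<Union>H\<in>?A. ?fib H)" by blast
  next
    fix F assume "F \<in> (\<Union>H\<in>?A. ?fib H)"
    then obtain H where H: "H \<in> ?A" and F: "F \<in> ?fib H" by blast
    then have bij: "bij_betw F J H" by simp
    have "hypergraph V H" "hconnected V H" using H by (auto simp: hypertree_def hyperforest_def)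
    then have "fam_connected V J F"
      using hconnected_iff_fam_connected relabel_family(1)[OF bij] by blast
    moreover have "F \<in> J \<rightarrow>\<^sub>E Pow V" using F sub[OF H] by (auto simp: PiE_iff)
    ultimately show "F \<in> families V J mu lam"
      using H F relabel_family(2)[OF bij] by (simp add: families_def)
  qed
  moreover have "card (\<Union>H\<in>?A. ?fib H) = (\<Sum>H\<in>?A. card (?fib H))"
  proof (rule card_UN_disjoint)
    show "finite ?A" by (rule finite_subset[of _ "Pow (Pow V)"]) (use sub fin in auto)
    show "\<forall>H\<in>?A. finite (?fib H)"
    proof
      fix H assume "H \<in> ?A"
      then have "finite (J \<rightarrow>\<^sub>E H)" by (intro finite_PiE fin(2) finH)
      then show "finite (?fib H)" by simp
    qed
    show "\<forall>H\<in>?A. \<forall>K\<in>?A. H \<noteq> K \<longrightarrow> ?fib H \<inter> ?fib K = {}"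
    proof (intro ballI impI)
      fix H K :: "'a set set" assume "H \<noteq> K"
      then show "?fib H \<inter> ?fib K = {}" unfolding bij_betw_def by blast
    qed
  qed
  ultimately show ?thesis using fib by simp
qed

section \<open>The number of hypertrees\<close>

theorem theorem1p1:
  fixes n k :: nat and lam mu nu :: "nat \<Rightarrow> nat"
  assumes "1 \<le> n" and "1 \<le> k" and "k \<le> n"
    and "n = (\<Sum>j=1..k. lam j)"
    and "\<And>i j. 1 \<le> i \<Longrightarrow> i \<le> j \<Longrightarrow> j \<le> k \<Longrightarrow> lam j \<le> lam i"
    and "\<And>j. 1 \<le> j \<Longrightarrow> j \<le> k \<Longrightarrow> 1 \<le> lam j"
    and "(\<Sum>j=0..n. mu j) = k - 1"
    and "\<And>j. nu j = card {i \<in> {1..k}. lam i = j}"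
  shows "real (card {H. hypertree {0..n} H \<and>
             (\<forall>i\<in>{0..n}. hdegree H i = 1 + mu i) \<and>
             card H = k \<and>
             image_mset card (mset_set H) = image_mset (\<lambda>j. 1 + lam j) (mset_set {1..k})})
           = multinomial n {1..k} lam * (1 / (\<Prod>j=1..n. fact (nu j))) * multinomial (k - 1) {0..n} mu
         \<and> multinomial n {1..k} lam * (1 / (\<Prod>j=1..n. fact (nu j))) * multinomial (k - 1) {0..n} mu
           = fact n / (\<Prod>j=1..k. fact (lam j)) * (1 / (\<Prod>j=1..n. fact (nu j)))
             * (fact (k - 1) / (\<Prod>j=0..n. fact (mu j)))"
proof -
  let ?A = "{H. hypertree {0..n} H \<and> (\<forall>i\<in>{0..n}. hdegree H i = 1 + mu i) \<and> card H = k \<and>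
             image_mset card (mset_set H) = image_mset (\<lambda>j. 1 + lam j) (mset_set {1..k})}"
  have "lam j \<le> n" if "j \<in> {1..k}" for j
    unfolding assms(4) by (rule member_le_sum) (use that in auto)
  then have "lam ` {1..k} \<subseteq> {1..n}" using assms(6) by auto
  then have "card ?A * (\<Prod>j=1..n. fact (nu j)) = card (families {0..n} {1..k} mu lam)"
    using card_hypertrees_relabelled[of "{0..n}" "{1..k}" lam "{1..n}" mu] assms by simp
  moreover have "card (families {0..n} {1..k} mu lam) * ((\<Prod>j=1..k. fact (lam j)) * (\<Prod>i=0..n. fact (mu i)))
      = fact n * fact (k - 1)"
    using card_families[of "{0..n}" "{1..k}" mu lam] assms by simp
  ultimately have "card ?A * (\<Prod>j=1..n. fact (nu j)) * ((\<Prod>j=1..k. fact (lam j)) * (\<Prod>i=0..n. fact (mu i)))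
      = fact n * fact (k - 1)"
    by simp
  then have "real (card ?A * (\<Prod>j=1..n. fact (nu j)) * ((\<Prod>j=1..k. fact (lam j)) * (\<Prod>i=0..n. fact (mu i))))
      = real (fact n * fact (k - 1))"
    by (rule arg_cong)
  then have "real (card ?A) * (\<Prod>j=1..n. fact (nu j)) * ((\<Prod>j=1..k. fact (lam j)) * (\<Prod>i=0..n. fact (mu i)))
      = fact n * fact (k - 1)"
    by simp
  moreover have "(\<Prod>j=1..n. fact (nu j) :: real) \<noteq> 0" "(\<Prod>j=1..k. fact (lam j) :: real) \<noteq> 0"
      "(\<Prod>i=0..n. fact (mu i) :: real) \<noteq> 0"
    by simp_all
  ultimately show ?thesis
    unfolding multinomial_def by (simp add: field_simps)
qed

end
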